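(* Let $\kappa$ be a cardinal, let $\mu$ be an infinite cardinal, and let $X$ be the one-point Lindelöfication of a discrete space of size $\mu$. Then $Nt(PR(X)) \leq \kappa$ if and only if there is a $(\kappa, \aleph_1)$-sparse cofinal family in $([\mu]^\omega, \subseteq)$.
   Context: The one-point Lindelöfication of a discrete space of size $\mu$ is the space $A_{\omega_1}(\mu)$ on $\mu\cup\{p\}$ (with $p\notin\mu$) in which every point of $\mu$ is isolated and the basic neighbourhoods of $p$ are the sets $\{p\}\cup(\mu\setminus C)$ with $C\subseteq\mu$ countable. For a space $(X,\tau)$, the Pixley-Roy hyperspace $PR(X)$ is the set $[X]^{<\omega}$ of finite subsets of $X$ with the topology having as a base the sets $[F,U]=\{G\in PR(X): F\subset G\subset U\}$, for $F\in PR(X)$ and $U\in\tau$. $[\mu]^\omega$ is the set of countably infinite subsets of $\mu$. A family $\mathcal{F}$ of countably infinite sets is $(\kappa,\nu)$-sparse if for every $\mathcal{G}\subset\mathcal{F}$ with $|\mathcal{G}|\geq\kappa$ we have $|\bigcup\mathcal{G}|\geq\nu$. A family $\mathcal{B}$ of sets is $\kappa^{op}$-like (with respect to $\supseteq$) if every bounded subset of $(\mathcal{B},\supseteq)$ has size strictly less than $\kappa$, i.e. for every $B\in\mathcal{B}$, the set $\{C\in\mathcal{B}:B\subseteq C\}$ has cardinality less than $\kappa$. The Noetherian type $Nt(Z)$ of a space $Z$ is the minimum cardinal $\kappa$ such that $Z$ has a $\kappa^{op}$-like base. *)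

theory Defs
  imports "HOL-Analysis.Abstract_Topology" "HOL-Library.Countable_Set"
begin

unbundle cardinal_syntax

definition one_point_Lindelofication :: "'a \<Rightarrow> 'a set \<Rightarrow> 'a topology" where
  "one_point_Lindelofication p D = topology (arbitrary union_of
     (\<lambda>N. (\<exists>x\<in>D. N = {x}) \<or> (\<exists>C. C \<subseteq> D \<and> countable C \<and> N = insert p (D - C))))"

text \<open>
  \<^const>\<open>Fpow\<close> is the set of all finite subsets, so the empty set is a point of the
  Pixley-Roy hyperspace.
\<close>

definition Pixley_Roy_basic :: "'a topology \<Rightarrow> 'a set \<Rightarrow> 'a set \<Rightarrow> 'a set set" where
  "Pixley_Roy_basic X F U = {G \<in> Fpow (topspace X). F \<subseteq> G \<and> G \<subseteq> U}"

definition Pixley_Roy :: "'a topology \<Rightarrow> 'a set topology" where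
  "Pixley_Roy X = topology (arbitrary union_of
     (\<lambda>W. \<exists>F\<in>Fpow (topspace X). \<exists>U. openin X U \<and> W = Pixley_Roy_basic X F U))"

definition is_base :: "'a topology \<Rightarrow> 'a set set \<Rightarrow> bool" where
  "is_base Z \<B> \<longleftrightarrow> openin Z = arbitrary union_of (\<lambda>U. U \<in> \<B>)"

text \<open>
  Cardinals are represented by relations \<open>\<kappa>\<close> with \<^term>\<open>Card_order \<kappa>\<close>, on a type that
  need not be related to the types of the sets measured.
\<close>

definition op_like :: "'k rel \<Rightarrow> 'a set set \<Rightarrow> bool" where
  "op_like \<kappa> \<B> \<longleftrightarrow> (\<forall>B\<in>\<B>. card_of {C \<in> \<B>. B \<subseteq> C} <o \<kappa>)"

definition has_op_like_base :: "'a topology \<Rightarrow> 'k rel \<Rightarrow> bool" where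
  "has_op_like_base Z \<kappa> \<longleftrightarrow> (\<exists>\<B>. is_base Z \<B> \<and> op_like \<kappa> \<B>)"

text \<open>
  The minimum is taken over the cardinals on the type \<^typ>\<open>'a set set\<close>. This loses nothing:
  every base of \<open>Z\<close> has fewer than \<open>|Pow (Pow (topspace Z))|\<close> elements, and that cardinal
  lives on \<^typ>\<open>'a set set\<close>. The lemmas \<open>has_op_like_base_Noetherian_type\<close> and
  \<open>Noetherian_type_minimal\<close> below show that the minimum is attained and that it is a lower
  bound among cardinals on arbitrary types.
\<close>

definition Noetherian_type :: "'a topology \<Rightarrow> 'a set set rel" where
  "Noetherian_type Z = (SOME \<kappa>. Card_order \<kappa> \<and> has_op_like_base Z \<kappa> \<and>
     (\<forall>\<nu> :: 'a set set rel. Card_order \<nu> \<and> has_op_like_base Z \<nu> \<longrightarrow> \<kappa> \<le>o \<nu>))"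

definition countably_infinite_subsets :: "'a set \<Rightarrow> 'a set set" where
  "countably_infinite_subsets S = {A. A \<subseteq> S \<and> countable A \<and> infinite A}"

definition cofinal_family :: "'a set set \<Rightarrow> 'a set set \<Rightarrow> bool" where
  "cofinal_family \<A> \<F> \<longleftrightarrow> \<F> \<subseteq> \<A> \<and> (\<forall>A\<in>\<A>. \<exists>B\<in>\<F>. A \<subseteq> B)"

definition sparse_family :: "'k rel \<Rightarrow> 'n rel \<Rightarrow> 'a set set \<Rightarrow> bool" where
  "sparse_family \<kappa> \<nu> \<F> \<longleftrightarrow> (\<forall>A\<in>\<F>. countable A \<and> infinite A) \<and>
     (\<forall>\<G>. \<G> \<subseteq> \<F> \<and> \<kappa> \<le>o card_of \<G> \<longrightarrow> \<nu> \<le>o card_of (\<Union>\<G>))"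

abbreviation aleph1 :: "nat set rel" where
  "aleph1 \<equiv> cardSuc natLeq"


lemma openin_one_point_Lindelofication:
  "openin (one_point_Lindelofication p D) = arbitrary union_of
     (\<lambda>N. (\<exists>x\<in>D. N = {x}) \<or> (\<exists>C. C \<subseteq> D \<and> countable C \<and> N = insert p (D - C)))"
  (is "_ = arbitrary union_of ?P")
proof -
  have "(arbitrary union_of ?P) (S \<inter> T)" if S: "?P S" and T: "?P T" for S T
  proof (cases "S \<inter> T = {} \<or> (\<exists>x\<in>D. S = {x}) \<or> (\<exists>x\<in>D. T = {x})")
    case True
    then have "S \<inter> T = {} \<or> ?P (S \<inter> T)"
      by auto
    then show ?thesis
      by (elim disjE) (auto intro: arbitrary_union_of_inc)
  next
    case False
    then obtain C C' where "C \<subseteq> D" "countable C" "S = insert p (D - C)"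
      "C' \<subseteq> D" "countable C'" "T = insert p (D - C')"
      using S T by auto
    then have "?P (S \<inter> T)"
      by (intro disjI2 exI[of _ "C \<union> C'"]) auto
    then show ?thesis
      by (rule arbitrary_union_of_inc)
  qed
  then have "istopology (arbitrary union_of ?P)"
    unfolding istopology_base_eq by (intro allI impI) (elim conjE)
  then show ?thesis
    by (simp add: one_point_Lindelofication_def topology_inverse')
qed

lemma topspace_one_point_Lindelofication:
  "topspace (one_point_Lindelofication p D) = insert p D"
proof -
  have "openin (one_point_Lindelofication p D) (insert p D)"
    unfolding openin_one_point_Lindelofication
    by (rule arbitrary_union_of_inc) (auto intro!: exI[of _ "{}"])
  moreover have "U \<subseteq> insert p D" if "openin (one_point_Lindelofication p D) U" for U
    using that unfolding openin_one_point_Lindelofication union_of_def by auto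
  ultimately show ?thesis
    by (metis openin_subset openin_topspace subset_antisym)
qed

lemma openin_Pixley_Roy:
  "openin (Pixley_Roy X) = arbitrary union_of
     (\<lambda>W. \<exists>F\<in>Fpow (topspace X). \<exists>U. openin X U \<and> W = Pixley_Roy_basic X F U)"
  (is "_ = arbitrary union_of ?P")
proof -
  have "istopology (arbitrary union_of ?P)"
  proof (rule istopology_base)
    fix S T assume "?P S" "?P T"
    then obtain F U F' U' where "F \<in> Fpow (topspace X)" "openin X U" "S = Pixley_Roy_basic X F U"
      "F' \<in> Fpow (topspace X)" "openin X U'" "T = Pixley_Roy_basic X F' U'"
      by blast
    then show "?P (S \<inter> T)"
      by (intro bexI[of _ "F \<union> F'"] exI[of _ "U \<inter> U'"])
        (auto simp: Pixley_Roy_basic_def Fpow_def)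
  qed
  then show ?thesis
    by (simp add: Pixley_Roy_def topology_inverse')
qed

lemma topspace_Pixley_Roy: "topspace (Pixley_Roy X) = Fpow (topspace X)"
proof -
  have "Pixley_Roy_basic X {} (topspace X) = Fpow (topspace X)"
    by (auto simp: Pixley_Roy_basic_def Fpow_def)
  then have "openin (Pixley_Roy X) (Fpow (topspace X))"
    unfolding openin_Pixley_Roy
    by (intro arbitrary_union_of_inc) (metis empty_in_Fpow openin_topspace)
  moreover have "W \<subseteq> Fpow (topspace X)" if "openin (Pixley_Roy X) W" for W
    using that unfolding openin_Pixley_Roy union_of_def Pixley_Roy_basic_def by fastforce
  ultimately show ?thesis
    by (metis openin_subset openin_topspace subset_antisym)
qed

lemma has_op_like_base_mono:
  assumes "has_op_like_base Z \<kappa>" "\<kappa> \<le>o \<nu>"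
  shows "has_op_like_base Z \<nu>"
  using assms unfolding has_op_like_base_def op_like_def
  by (meson ordLess_ordLeq_trans)

lemma has_op_like_base_Pow_Pow: "has_op_like_base Z (card_of (Pow (Pow (topspace Z))))"
proof -
  let ?\<B> = "Collect (openin Z)"
  have "(\<lambda>U. U \<in> ?\<B>) = openin Z"
    by simp
  then have "is_base Z ?\<B>"
    unfolding is_base_def
    by (metis istopology_openin openin_topology_base_unique order_refl)
  moreover have "card_of {C \<in> ?\<B>. B \<subseteq> C} <o card_of (Pow (Pow (topspace Z)))" for B
  proof -
    have "card_of {C \<in> ?\<B>. B \<subseteq> C} \<le>o card_of (Pow (topspace Z))"
      by (rule card_of_mono1) (auto dest: openin_subset)
    then show ?thesis
      using card_of_Pow ordLeq_ordLess_trans by blast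
  qed
  ultimately show ?thesis
    unfolding has_op_like_base_def op_like_def by (intro exI[of _ ?\<B>] conjI ballI)
qed

lemma Noetherian_type_props:
  fixes Z :: "'a topology"
  shows "Card_order (Noetherian_type Z) \<and> has_op_like_base Z (Noetherian_type Z) \<and>
    (\<forall>\<nu> :: 'a set set rel. Card_order \<nu> \<and> has_op_like_base Z \<nu> \<longrightarrow> Noetherian_type Z \<le>o \<nu>)"
proof -
  let ?R = "{\<kappa> :: 'a set set rel. Card_order \<kappa> \<and> has_op_like_base Z \<kappa>}"
  have "?R \<noteq> {}"
    using has_op_like_base_Pow_Pow[of Z] card_of_Card_order by blast
  then have "\<exists>\<kappa>\<in>?R. \<forall>\<nu>\<in>?R. \<kappa> \<le>o \<nu>"
    by (intro exists_minim_Card_order) auto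
  then show ?thesis
    unfolding Noetherian_type_def Bex_def Ball_def mem_Collect_eq conj_assoc by (rule someI_ex)
qed

lemma Card_order_Noetherian_type: "Card_order (Noetherian_type Z)"
  by (rule Noetherian_type_props[THEN conjunct1])

lemma has_op_like_base_Noetherian_type: "has_op_like_base Z (Noetherian_type Z)"
  by (rule Noetherian_type_props[THEN conjunct2, THEN conjunct1])

lemma Noetherian_type_minimal:
  fixes Z :: "'a topology" and \<kappa> :: "'k rel"
  assumes \<kappa>: "Card_order \<kappa>" and base: "has_op_like_base Z \<kappa>"
  shows "Noetherian_type Z \<le>o \<kappa>"
proof -
  let ?P = "card_of (Pow (Pow (topspace Z)))"
  have min: "Noetherian_type Z \<le>o \<nu>"
    if "Card_order \<nu>" "has_op_like_base Z \<nu>" for \<nu> :: "'a set set rel"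
    using that Noetherian_type_props[of Z] by blast
  consider "?P \<le>o \<kappa>" | "\<kappa> \<le>o ?P"
    using ordLeq_total[OF card_of_Well_order card_order_on_well_order_on[OF \<kappa>]] by blast
  then show ?thesis
  proof cases
    case 1
    then show ?thesis
      by (rule ordLeq_transitive[OF min[OF card_of_Card_order has_op_like_base_Pow_Pow]])
  next
    case 2
    then have "card_of (Field \<kappa>) \<le>o ?P"
      by (rule ordIso_ordLeq_trans[OF card_of_Field_ordIso[OF \<kappa>]])
    then obtain A where "card_of (Field \<kappa>) =o card_of (A :: 'a set set set)"
      using internalize_card_of_ordLeq2[of "Field \<kappa>" "Pow (Pow (topspace Z))"] by blast
    then have iso: "\<kappa> =o card_of A"
      by (rule ordIso_transitive[OF ordIso_symmetric[OF card_of_Field_ordIso[OF \<kappa>]]])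
    then have "has_op_like_base Z (card_of A)"
      by (rule has_op_like_base_mono[OF base ordIso_imp_ordLeq])
    then have "Noetherian_type Z \<le>o card_of A"
      by (rule min[OF card_of_Card_order])
    then show ?thesis
      by (rule ordLeq_ordIso_trans[OF _ ordIso_symmetric[OF iso]])
  qed
qed

end

theory Submission
  imports Defs
begin

text \<open>
  Let \<open>X\<close> be the one-point Lindelofication of \<open>D\<close>, and write \<open>[F, U]\<close> for the basic open sets of
  the Pixley-Roy space. Sending each member \<open>B\<close> of a base that contains \<open>{p}\<close> to a countable \<open>c B\<close>
  with \<open>[{p}, X - c B] \<subseteq> B\<close> yields a sparse cofinal family: if countably many points cover all
  \<open>c B\<close>, \<open>B \<in> \<S>\<close>, then one base member lies below all of \<open>\<S>\<close>, so \<open>\<S>\<close> is small. Conversely, a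
  sparse cofinal family \<open>\<F>\<close> gives the base consisting of the singletons \<open>{F}\<close> with \<open>p \<notin> F\<close> and the
  sets \<open>[F, X - (A - F)]\<close> with \<open>p \<in> F\<close>, \<open>A \<in> \<F>\<close>: only finitely many \<open>F'\<close> and only those
  \<open>A' \<in> \<F>\<close> inside the countable set \<open>A \<union> F\<close> occur above a given member. Summing over the
  \<open>F'\<close> requires \<open>\<kappa>\<close> to be infinite. Sparseness forces this when \<open>D\<close> is uncountable;
  when \<open>D\<close> is countable the Pixley-Roy space is discrete.
\<close>

section \<open>Bases, and sparseness via countable unions\<close>

lemma is_base_iff:
  "is_base Z \<B> \<longleftrightarrow> (\<forall>B\<in>\<B>. openin Z B) \<and>
     (\<forall>U x. openin Z U \<and> x \<in> U \<longrightarrow> (\<exists>B\<in>\<B>. x \<in> B \<and> B \<subseteq> U))"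
  unfolding is_base_def openin_topology_base_unique by blast

lemma is_baseI:
  assumes "\<And>B. B \<in> \<B> \<Longrightarrow> openin Z B"
    and "\<And>U x. openin Z U \<Longrightarrow> x \<in> U \<Longrightarrow> \<exists>B\<in>\<B>. x \<in> B \<and> B \<subseteq> U"
  shows "is_base Z \<B>"
  using assms by (simp add: is_base_iff)

lemma base_nbhd:
  assumes "openin X = arbitrary union_of P" "openin X U" "x \<in> U"
  obtains V where "P V" "x \<in> V" "V \<subseteq> U"
  using assms openin_topology_base_unique[of X P] by blast

text \<open>The successor of \<open>natLeq\<close> lies below a cardinal iff \<open>natLeq\<close>
  lies strictly below it; by totality this denies an injection into the naturals.\<close>

lemma aleph1_ordLeq_card_of_iff: "aleph1 \<le>o card_of S \<longleftrightarrow> uncountable S"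
proof -
  have "aleph1 \<le>o card_of S \<longleftrightarrow> natLeq <o card_of S"
    by (simp add: cardSuc_ordLess_ordLeq natLeq_Card_order card_of_card_order_on Field_card_of)
  also have "\<dots> \<longleftrightarrow> \<not> card_of S \<le>o natLeq"
    by (metis card_of_Well_order natLeq_Well_order not_ordLeq_iff_ordLess)
  also have "card_of S \<le>o natLeq \<longleftrightarrow> card_of S \<le>o card_of (UNIV :: nat set)"
    using card_of_nat ordIso_symmetric ordLeq_ordIso_trans by blast
  finally show ?thesis
    by (simp add: countable_def flip: card_of_ordLeq)
qed

text \<open>The contrapositive of sparseness, by comparability of cardinals. Both directions of the
  theorem use it in this form.\<close>

lemma sparse_family_aleph1_iff:
  assumes "Card_order \<kappa>"
  shows "sparse_family \<kappa> aleph1 \<F> \<longleftrightarrow> (\<forall>A\<in>\<F>. countable A \<and> infinite A) \<and>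
    (\<forall>\<G>\<subseteq>\<F>. countable (\<Union>\<G>) \<longrightarrow> card_of \<G> <o \<kappa>)"
proof -
  have "\<kappa> \<le>o card_of \<G> \<longleftrightarrow> \<not> card_of \<G> <o \<kappa>" for \<G> :: "'b set set"
    using assms by (metis card_of_Well_order card_order_on_well_order_on not_ordLeq_iff_ordLess)
  then show ?thesis
    unfolding sparse_family_def aleph1_ordLeq_card_of_iff by blast
qed

lemma sparse_family_aleph1D:
  assumes "sparse_family \<kappa> aleph1 \<F>" "Card_order \<kappa>" "\<G> \<subseteq> \<F>" "countable (\<Union>\<G>)"
  shows "card_of \<G> <o \<kappa>"
  using assms by (simp add: sparse_family_aleph1_iff)

lemma cofinal_familyD:
  assumes "cofinal_family \<A> \<F>" "A \<in> \<A>"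
  shows "\<exists>B\<in>\<F>. A \<subseteq> B"
  using assms by (simp add: cofinal_family_def)

text \<open>The theorem places the family on \<open>Field \<mu>\<close> and the space on
  \<open>D\<close>, possibly over different types. Images under \<open>h\<close> carry the family
  across.\<close>

lemma sparse_cofinal_family_transfer:
  assumes \<kappa>: "Card_order \<kappa>" and h: "bij_betw h D E"
    and cof: "cofinal_family (countably_infinite_subsets D) \<F>"
    and sp: "sparse_family \<kappa> aleph1 \<F>"
  shows "\<exists>\<F>'. cofinal_family (countably_infinite_subsets E) \<F>' \<and> sparse_family \<kappa> aleph1 \<F>'"
proof (intro exI conjI)
  let ?\<F> = "(`) h ` \<F>"
  have inj: "inj_on h D" and im: "h ` D = E"
    using h by (auto simp: bij_betw_def)
  have \<F>: "A \<subseteq> D \<and> countable A \<and> infinite A" if "A \<in> \<F>" for A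
    using that cof by (auto simp: cofinal_family_def countably_infinite_subsets_def)
  have inf: "infinite (h ` A)" if "A \<in> \<F>" for A
    using \<F>[OF that] inj by (meson finite_imageD inj_on_subset)
  show "cofinal_family (countably_infinite_subsets E) ?\<F>"
    unfolding cofinal_family_def
  proof (intro conjI ballI)
    show "?\<F> \<subseteq> countably_infinite_subsets E"
      using \<F> inf im by (auto simp: countably_infinite_subsets_def)
  next
    fix A assume "A \<in> countably_infinite_subsets E"
    then have A: "A \<subseteq> h ` D" "countable A" "infinite A"
      using im by (auto simp: countably_infinite_subsets_def)
    obtain A0 where A0: "A0 \<subseteq> D" "A = h ` A0" "inj_on h A0"
      using A(1) by (metis subset_image_inj)
    then have "A0 \<in> countably_infinite_subsets D"
      using A by (auto simp: countably_infinite_subsets_def dest: countable_image_inj_on)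
    then obtain B where "B \<in> \<F>" "A0 \<subseteq> B"
      using cof by (auto simp: cofinal_family_def)
    then show "\<exists>B\<in>?\<F>. A \<subseteq> B"
      using A0 by blast
  qed
  show "sparse_family \<kappa> aleph1 ?\<F>"
    unfolding sparse_family_aleph1_iff[OF \<kappa>]
  proof (intro conjI ballI allI impI)
    fix \<G> assume "\<G> \<subseteq> ?\<F>" "countable (\<Union>\<G>)"
    then obtain \<G>0 where \<G>0: "\<G>0 \<subseteq> \<F>" "\<G> = (`) h ` \<G>0"
      by (meson subset_imageE)
    have "h ` \<Union>\<G>0 = \<Union>\<G>"
      using \<G>0 by blast
    moreover have "inj_on h (\<Union>\<G>0)"
      using \<F> \<G>0(1) by (intro inj_on_subset[OF inj]) blast
    ultimately have "countable (\<Union>\<G>0)"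
      using \<open>countable (\<Union>\<G>)\<close> by (metis countable_image_inj_on)
    then have "card_of \<G>0 <o \<kappa>"
      by (rule sparse_family_aleph1D[OF sp \<kappa> \<G>0(1)])
    then show "card_of \<G> <o \<kappa>"
      unfolding \<G>0(2) using card_of_image ordLeq_ordLess_trans by blast
  qed (use \<F> inf in auto)
qed

text \<open>The minimum is attained, and a base that works for one cardinal works for every larger
  one; so only the existence of a base remains to be studied.\<close>

lemma Noetherian_type_ordLeq_iff:
  assumes "Card_order \<kappa>"
  shows "Noetherian_type Z \<le>o \<kappa> \<longleftrightarrow> has_op_like_base Z \<kappa>"
  using assms Noetherian_type_minimal has_op_like_base_mono has_op_like_base_Noetherian_type
  by blast

section \<open>Open sets and neighbourhoods in the two spaces\<close>

lemma openin_one_point_Lindelofication_subset: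
  assumes "U \<subseteq> D"
  shows "openin (one_point_Lindelofication p D) U"
proof -
  have "openin (one_point_Lindelofication p D) {x}" if "x \<in> U" for x
    unfolding openin_one_point_Lindelofication
    using that assms by (intro arbitrary_union_of_inc disjI1) blast
  then have "openin (one_point_Lindelofication p D) (\<Union>x\<in>U. {x})"
    by blast
  then show ?thesis
    by simp
qed

lemma openin_one_point_Lindelofication_co_countable:
  assumes "countable C" "p \<notin> C"
  shows "openin (one_point_Lindelofication p D) (insert p D - C)"
  unfolding openin_one_point_Lindelofication
  using assms by (intro arbitrary_union_of_inc disjI2 exI[of _ "C \<inter> D"]) auto

lemma one_point_Lindelofication_nbhd:
  assumes "openin (one_point_Lindelofication p D) U" "p \<in> U" "p \<notin> D"
  obtains C where "C \<subseteq> D" "countable C" "insert p D - C \<subseteq> U"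
proof -
  obtain N where N: "(\<exists>x\<in>D. N = {x}) \<or> (\<exists>C. C \<subseteq> D \<and> countable C \<and> N = insert p (D - C))"
    "p \<in> N" "N \<subseteq> U"
    using base_nbhd[OF openin_one_point_Lindelofication assms(1,2)] by metis
  \<comment> \<open>Since \<open>p \<notin> D\<close>, no singleton \<open>{x}\<close> with
    \<open>x \<in> D\<close> contains \<open>p\<close>.\<close>
  then obtain C where "C \<subseteq> D" "countable C" "N = insert p (D - C)"
    using assms(3) by auto
  then show ?thesis
    using N(3) by (intro that[of C]) auto
qed

lemma openin_Pixley_Roy_basic:
  assumes "F \<in> Fpow (topspace X)" "openin X U"
  shows "openin (Pixley_Roy X) (Pixley_Roy_basic X F U)"
  unfolding openin_Pixley_Roy using assms by (intro arbitrary_union_of_inc) blast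

text \<open>A basic set around \<open>F\<close> may have a smaller lower bound \<open>F'\<close>;
  raising that bound to \<open>F\<close> only shrinks the set.\<close>

lemma Pixley_Roy_nbhd:
  assumes "openin (Pixley_Roy X) W" "F \<in> W"
  obtains U where "openin X U" "F \<subseteq> U" "Pixley_Roy_basic X F U \<subseteq> W"
proof -
  obtain F' U where "openin X U" "F \<in> Pixley_Roy_basic X F' U" "Pixley_Roy_basic X F' U \<subseteq> W"
    using base_nbhd[OF openin_Pixley_Roy assms] by metis
  then show ?thesis
    by (intro that[of U]) (auto simp: Pixley_Roy_basic_def)
qed

text \<open>Taking \<open>F\<close> as both lower and upper bound isolates it.\<close>

lemma openin_Pixley_Roy_singleton:
  assumes "finite F" "openin X F"
  shows "openin (Pixley_Roy X) {F}"
proof -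
  have "F \<in> Fpow (topspace X)"
    using assms by (simp add: Fpow_def openin_subset)
  moreover from this have "Pixley_Roy_basic X F F = {F}"
    by (auto simp: Pixley_Roy_basic_def)
  ultimately show ?thesis
    using assms(2) openin_Pixley_Roy_basic by metis
qed

section \<open>From a base to a sparse cofinal family\<close>

lemma sparse_cofinal_family_if_op_like_base:
  assumes \<kappa>: "Card_order \<kappa>" and D: "infinite D" and p: "p \<notin> D"
    and base: "has_op_like_base (Pixley_Roy (one_point_Lindelofication p D)) \<kappa>"
  shows "\<exists>\<F>. cofinal_family (countably_infinite_subsets D) \<F> \<and> sparse_family \<kappa> aleph1 \<F>"
proof -
  let ?X = "one_point_Lindelofication p D"
  let ?N = "\<lambda>C. Pixley_Roy_basic ?X {p} (insert p D - C)"
  obtain \<B> where B: "is_base (Pixley_Roy ?X) \<B>" and op: "op_like \<kappa> \<B>"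
    using base by (auto simp: has_op_like_base_def)
  define \<B>p where "\<B>p = {B \<in> \<B>. {p} \<in> B}"
  \<comment> \<open>Used twice: with a given countable set for cofinality, and with the union of a
    subfamily for sparseness.\<close>
  have inside: "\<exists>B\<in>\<B>p. B \<subseteq> ?N C" if "C \<subseteq> D" "countable C" for C
  proof -
    have "openin (Pixley_Roy ?X) (?N C)"
      using that p
      by (intro openin_Pixley_Roy_basic openin_one_point_Lindelofication_co_countable)
        (auto simp: topspace_one_point_Lindelofication Fpow_def)
    moreover have "{p} \<in> ?N C"
      using that p
      by (auto simp: Pixley_Roy_basic_def topspace_one_point_Lindelofication Fpow_def)
    ultimately show ?thesis
      using B unfolding is_base_iff \<B>p_def by blast
  qed
  have "\<exists>C. C \<in> countably_infinite_subsets D \<and> ?N C \<subseteq> B" if "B \<in> \<B>p" for B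
  proof -
    have "openin (Pixley_Roy ?X) B" "{p} \<in> B"
      using that B by (auto simp: \<B>p_def is_base_iff)
    then obtain U where U: "openin ?X U" "p \<in> U" "Pixley_Roy_basic ?X {p} U \<subseteq> B"
      by (auto elim: Pixley_Roy_nbhd)
    obtain C where C: "C \<subseteq> D" "countable C" "insert p D - C \<subseteq> U"
      using one_point_Lindelofication_nbhd[OF U(1,2) p] .
    \<comment> \<open>\<open>C\<close> may be finite; \<open>C'\<close> pads it to an infinite set,
      and removing more points only shrinks the neighbourhood.\<close>
    obtain C' where C': "C' \<subseteq> D" "countable C'" "infinite C'"
      using infinite_countable_subset'[OF D] by blast
    have "?N (C \<union> C') \<subseteq> Pixley_Roy_basic ?X {p} U"
      using C(3) unfolding Pixley_Roy_basic_def by (intro Collect_mono) auto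
    then have "?N (C \<union> C') \<subseteq> B"
      using U(3) by (rule order_trans)
    moreover have "C \<union> C' \<in> countably_infinite_subsets D"
      using C C' by (auto simp: countably_infinite_subsets_def)
    ultimately show ?thesis
      by blast
  qed
  then obtain c where c: "\<And>B. B \<in> \<B>p \<Longrightarrow> c B \<in> countably_infinite_subsets D"
    "\<And>B. B \<in> \<B>p \<Longrightarrow> ?N (c B) \<subseteq> B"
    by metis
  have "cofinal_family (countably_infinite_subsets D) (c ` \<B>p)"
    unfolding cofinal_family_def
  proof (intro conjI ballI)
    show "c ` \<B>p \<subseteq> countably_infinite_subsets D"
      using c(1) by blast
  next
    fix A assume "A \<in> countably_infinite_subsets D"
    then have A: "A \<subseteq> D" "countable A"
      by (auto simp: countably_infinite_subsets_def)
    then obtain B where B: "B \<in> \<B>p" "B \<subseteq> ?N A"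
      using inside by blast
    \<comment> \<open>From \<open>?N (c B) \<subseteq> B \<subseteq> ?N A\<close>: for
      \<open>x\<close> in \<open>A\<close> but not in \<open>c B\<close>, the point
      \<open>{p, x}\<close> would lie in the first set but not in the last.\<close>
    have "A \<subseteq> c B"
    proof (rule ccontr)
      assume "\<not> A \<subseteq> c B"
      then obtain x where x: "x \<in> A" "x \<notin> c B"
        by blast
      have "p \<notin> c B"
        using c(1)[OF B(1)] p by (auto simp: countably_infinite_subsets_def)
      then have "{p, x} \<in> ?N (c B)"
        using x A
        by (auto simp: Pixley_Roy_basic_def topspace_one_point_Lindelofication Fpow_def)
      then have "{p, x} \<in> ?N A"
        using c(2)[OF B(1)] B(2) by blast
      then show False
        using x by (auto simp: Pixley_Roy_basic_def)
    qed
    then show "\<exists>B\<in>c ` \<B>p. A \<subseteq> B"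
      using B(1) by blast
  qed
  moreover have "sparse_family \<kappa> aleph1 (c ` \<B>p)"
    unfolding sparse_family_aleph1_iff[OF \<kappa>]
  proof (intro conjI ballI allI impI)
    fix \<G> assume "\<G> \<subseteq> c ` \<B>p" and count: "countable (\<Union>\<G>)"
    \<comment> \<open>\<open>c\<close> need not be injective, so the bound is proved for
      \<open>\<S>\<close> and passed to its image \<open>\<G>\<close>.\<close>
    then obtain \<S> where \<S>: "\<S> \<subseteq> \<B>p" "\<G> = c ` \<S>"
      by (meson subset_imageE)
    have "\<Union>\<G> \<subseteq> D"
      using \<S> c(1) by (fastforce simp: countably_infinite_subsets_def)
    then obtain B where B: "B \<in> \<B>p" "B \<subseteq> ?N (\<Union>\<G>)"
      using inside count by blast
    have "B \<subseteq> S" if "S \<in> \<S>" for S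
    proof -
      have "?N (\<Union>\<G>) \<subseteq> ?N (c S)"
        using that \<S>(2) by (auto simp: Pixley_Roy_basic_def)
      then show ?thesis
        using B(2) c(2)[of S] that \<S>(1) by blast
    qed
    then have "\<S> \<subseteq> {C \<in> \<B>. B \<subseteq> C}"
      using \<S>(1) by (auto simp: \<B>p_def)
    moreover have "card_of {C \<in> \<B>. B \<subseteq> C} <o \<kappa>"
      using op B(1) by (auto simp: op_like_def \<B>p_def)
    ultimately have "card_of \<S> <o \<kappa>"
      using card_of_mono1 ordLeq_ordLess_trans by blast
    then show "card_of \<G> <o \<kappa>"
      unfolding \<S>(2) using card_of_image ordLeq_ordLess_trans by blast
  qed (use c(1) in \<open>auto simp: countably_infinite_subsets_def\<close>)
  ultimately show ?thesis
    by blast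
qed

section \<open>From a sparse cofinal family to a base\<close>

text \<open>Every subset of \<open>insert p D\<close> is open here, so the singletons form a base in
  which only \<open>B\<close> lies above \<open>B\<close>. The hypothesis on \<open>A\<close>
  encodes \<open>1 < \<kappa>\<close>; \<open>\<kappa>\<close> may be finite.\<close>

lemma op_like_base_if_countable:
  assumes "countable D" "p \<notin> D" and \<kappa>: "card_of {A} <o \<kappa>"
  shows "has_op_like_base (Pixley_Roy (one_point_Lindelofication p D)) \<kappa>"
  unfolding has_op_like_base_def
proof (intro exI conjI)
  let ?X = "one_point_Lindelofication p D"
  let ?\<B> = "(\<lambda>F. {F}) ` Fpow (insert p D)"
  have "openin ?X F" if "F \<subseteq> insert p D" for F
  proof (cases "p \<in> F")
    case True
    then have "F = insert p D - (D - F)"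
      using that assms(2) by blast
    then show ?thesis
      using assms(1,2) openin_one_point_Lindelofication_co_countable[of "D - F" p D] by auto
  qed (use that in \<open>auto intro: openin_one_point_Lindelofication_subset\<close>)
  then have "openin (Pixley_Roy ?X) {F}" if "F \<in> Fpow (insert p D)" for F
    using that by (intro openin_Pixley_Roy_singleton) (auto simp: Fpow_def)
  moreover have "\<exists>B\<in>?\<B>. F \<in> B \<and> B \<subseteq> W" if "openin (Pixley_Roy ?X) W" "F \<in> W" for F W
    using openin_subset[OF that(1)] that(2)
    by (auto simp: topspace_Pixley_Roy topspace_one_point_Lindelofication)
  ultimately show "is_base (Pixley_Roy ?X) ?\<B>"
    unfolding is_base_iff by blast
  show "op_like \<kappa> ?\<B>"
    unfolding op_like_def
  proof
    fix B assume "B \<in> ?\<B>"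
    then have eq: "{C \<in> ?\<B>. B \<subseteq> C} = {B}"
      by auto
    have "card_of {C \<in> ?\<B>. B \<subseteq> C} =o card_of {A}"
      unfolding eq by (intro card_of_ordIsoI[of "\<lambda>_. A"]) (auto simp: bij_betw_def)
    then show "card_of {C \<in> ?\<B>. B \<subseteq> C} <o \<kappa>"
      using \<kappa> by (rule ordIso_ordLess_trans)
  qed
qed

lemma card_of_finite_ordLess:
  assumes "Card_order \<kappa>" "infinite (Field \<kappa>)" "finite A"
  shows "card_of A <o \<kappa>"
  using assms
  by (intro finite_ordLess_infinite)
    (auto simp: Field_card_of card_of_well_order_on card_order_on_well_order_on)

text \<open>An infinite \<open>A\<close> absorbs the finite factor; a finite \<open>A\<close> gives
  a finite product.\<close>

lemma card_of_finite_Times_ordLess: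
  assumes \<kappa>: "Card_order \<kappa>" "infinite (Field \<kappa>)" and I: "finite I" and A: "card_of A <o \<kappa>"
  shows "card_of (I \<times> A) <o \<kappa>"
proof (cases "finite A")
  case True
  then show ?thesis
    using I by (intro card_of_finite_ordLess[OF \<kappa>]) simp
next
  case False
  moreover have "card_of I <o card_of A"
    using False I by (intro card_of_finite_ordLess) (simp_all add: Field_card_of card_of_card_order_on)
  ultimately have "card_of (I \<times> A) \<le>o card_of A"
    by (intro card_of_Times_ordLeq_infinite_Field)
      (simp_all add: Field_card_of card_of_card_order_on ordLess_imp_ordLeq ordLeq_refl)
  then show ?thesis
    using A by (rule ordLeq_ordLess_trans)
qed

lemma op_like_base_if_infinite:
  assumes \<kappa>: "Card_order \<kappa>" "infinite (Field \<kappa>)" and D: "infinite D" and p: "p \<notin> D"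
    and cof: "cofinal_family (countably_infinite_subsets D) \<F>"
    and sp: "sparse_family \<kappa> aleph1 \<F>"
  shows "has_op_like_base (Pixley_Roy (one_point_Lindelofication p D)) \<kappa>"
  unfolding has_op_like_base_def
proof (intro exI conjI)
  let ?X = "one_point_Lindelofication p D"
  \<comment> \<open>Removing \<open>A - F\<close> instead of \<open>A\<close> keeps \<open>F\<close>
    below the upper bound, so \<open>F\<close> belongs to \<open>?N F A\<close> for every
    \<open>A\<close>.\<close>
  let ?N = "\<lambda>F A. Pixley_Roy_basic ?X F (insert p D - (A - F))"
  let ?S = "(\<lambda>F. {F}) ` Fpow D"
  let ?T = "{?N F A | F A. F \<in> Fpow (insert p D) \<and> p \<in> F \<and> A \<in> \<F>}"
  let ?\<B> = "?S \<union> ?T"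
  have \<F>: "A \<subseteq> D \<and> countable A" if "A \<in> \<F>" for A
    using that cof by (auto simp: cofinal_family_def countably_infinite_subsets_def)
  have open_S: "openin (Pixley_Roy ?X) {F}" if "F \<in> Fpow D" for F
    using that
    by (intro openin_Pixley_Roy_singleton openin_one_point_Lindelofication_subset)
      (auto simp: Fpow_def)
  have open_T: "openin (Pixley_Roy ?X) (?N F A)"
    if "F \<in> Fpow (insert p D)" "p \<in> F" "A \<in> \<F>" for F A
    using that \<F>[OF that(3)]
    by (intro openin_Pixley_Roy_basic openin_one_point_Lindelofication_co_countable)
      (auto simp: topspace_one_point_Lindelofication)
  have "\<exists>B\<in>?\<B>. F \<in> B \<and> B \<subseteq> W" if W: "openin (Pixley_Roy ?X) W" "F \<in> W" for F W
  proof (cases "p \<in> F")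
    case False
    then have "{F} \<in> ?S"
      using openin_subset[OF W(1)] W(2)
      by (auto simp: topspace_Pixley_Roy topspace_one_point_Lindelofication Fpow_def)
    then show ?thesis
      using W(2) by (intro bexI[of _ "{F}"]) auto
  next
    case True
    have F: "F \<in> Fpow (insert p D)"
      using openin_subset[OF W(1)] W(2)
      by (auto simp: topspace_Pixley_Roy topspace_one_point_Lindelofication)
    obtain U where U: "openin ?X U" "F \<subseteq> U" "Pixley_Roy_basic ?X F U \<subseteq> W"
      using Pixley_Roy_nbhd[OF W] .
    obtain C where C: "C \<subseteq> D" "countable C" "insert p D - C \<subseteq> U"
      using one_point_Lindelofication_nbhd[OF U(1) _ p] U(2) True by blast
    obtain C' where "C' \<subseteq> D" "countable C'" "infinite C'"
      using infinite_countable_subset'[OF D] by blast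
    then have "C \<union> C' \<in> countably_infinite_subsets D"
      using C by (auto simp: countably_infinite_subsets_def)
    then obtain A where A: "A \<in> \<F>" "C \<subseteq> A"
      using cofinal_familyD[OF cof] by blast
    have "insert p D - (A - F) \<subseteq> U"
      using A(2) C(3) U(2) by blast
    then have "?N F A \<subseteq> Pixley_Roy_basic ?X F U"
      unfolding Pixley_Roy_basic_def by (intro Collect_mono) auto
    then have "?N F A \<subseteq> W"
      using U(3) by (rule order_trans)
    moreover have "F \<in> ?N F A"
      using F by (auto simp: Pixley_Roy_basic_def topspace_one_point_Lindelofication Fpow_def)
    ultimately show ?thesis
      using F True A(1) by blast
  qed
  moreover have "openin (Pixley_Roy ?X) B" if "B \<in> ?\<B>" for B
    using that open_S open_T by (elim UnE imageE CollectE exE conjE) simp_all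
  ultimately show "is_base (Pixley_Roy ?X) ?\<B>"
    by (intro is_baseI)
  show "op_like \<kappa> ?\<B>"
    unfolding op_like_def
  proof
    fix B assume "B \<in> ?\<B>"
    then consider (S) F where "F \<in> Fpow D" "B = {F}"
      | (T) F A where "F \<in> Fpow (insert p D)" "p \<in> F" "A \<in> \<F>" "B = ?N F A"
      by blast
    then show "card_of {C \<in> ?\<B>. B \<subseteq> C} <o \<kappa>"
    proof cases
      case S
      then have "p \<notin> F"
        using p by (auto simp: Fpow_def)
      \<comment> \<open>Every point of a member of \<open>?T\<close> contains \<open>p\<close>,
        whereas \<open>F\<close> does not; hence only \<open>{F}\<close> itself lies above
        \<open>{F}\<close>.\<close>
      then have "F \<notin> ?N F' A" if "p \<in> F'" for F' A
        using that by (auto simp: Pixley_Roy_basic_def)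
      then have "C \<notin> ?T" if "F \<in> C" for C
        using that by blast
      then have "{C \<in> ?\<B>. B \<subseteq> C} \<subseteq> {B}"
        using S(2) by blast
      then have "finite {C \<in> ?\<B>. B \<subseteq> C}"
        by (rule finite_subset) simp
      then show ?thesis
        by (rule card_of_finite_ordLess[OF \<kappa>])
    next
      case T
      let ?\<G> = "{A' \<in> \<F>. A' \<subseteq> A \<union> F}"
      have fin: "finite F"
        using T(1) by (simp add: Fpow_def)
      have "countable (\<Union>?\<G>)"
        by (rule countable_subset[of _ "A \<union> F"])
          (use \<F>[OF T(3)] fin in \<open>auto intro: countable_finite\<close>)
      then have "card_of ?\<G> <o \<kappa>"
        by (intro sparse_family_aleph1D[OF sp \<kappa>(1)]) auto
      then have "card_of (Pow F \<times> ?\<G>) <o \<kappa>"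
        using fin by (intro card_of_finite_Times_ordLess[OF \<kappa>]) simp
      moreover have "{C \<in> ?\<B>. B \<subseteq> C} \<subseteq> (\<lambda>(F', A'). ?N F' A') ` (Pow F \<times> ?\<G>)"
      proof
        fix C assume "C \<in> {C \<in> ?\<B>. B \<subseteq> C}"
        then have C: "C \<in> ?\<B>" "?N F A \<subseteq> C"
          using T(4) by auto
        \<comment> \<open>The point \<open>F\<close> lies in every \<open>C\<close> above
          \<open>B\<close>: this excludes the singletons in \<open>?S\<close> and forces
          \<open>F' \<subseteq> F\<close>.\<close>
        have "F \<in> ?N F A"
          using T(1) by (auto simp: Pixley_Roy_basic_def topspace_one_point_Lindelofication Fpow_def)
        then have "F \<in> C"
          using C(2) by blast
        then have "C \<notin> ?S"
          using p T(2) by (auto simp: Fpow_def)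
        then obtain F' A' where C': "C = ?N F' A'" "A' \<in> \<F>"
          using C(1) by blast
        have F': "F' \<subseteq> F"
          using \<open>F \<in> C\<close> unfolding C'(1) by (auto simp: Pixley_Roy_basic_def)
        \<comment> \<open>The test point is \<open>insert x F\<close>: if \<open>x\<close> were
          outside \<open>A \<union> F\<close>, it would lie in \<open>?N F A\<close>, but
          \<open>?N F' A'\<close> omits it because \<open>x \<in> A' - F'\<close>.\<close>
        have "x \<in> A \<union> F" if x: "x \<in> A'" for x
        proof (rule ccontr)
          assume "x \<notin> A \<union> F"
          then have "insert x F \<in> ?N F A"
            using T(1) \<F>[OF C'(2)] x
            by (auto simp: Pixley_Roy_basic_def topspace_one_point_Lindelofication Fpow_def)
          then have "insert x F \<in> ?N F' A'"
            using C(2) unfolding C'(1) by blast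
          then show False
            using x F' \<open>x \<notin> A \<union> F\<close> by (auto simp: Pixley_Roy_basic_def)
        qed
        then show "C \<in> (\<lambda>(F', A'). ?N F' A') ` (Pow F \<times> ?\<G>)"
          using C' F' by blast
      qed
      ultimately show ?thesis
        by (meson card_of_image card_of_mono1 ordLeq_ordLess_trans)
    qed
  qed
qed

text \<open>Finitely many countable sets miss some \<open>x \<in> D\<close>, so no member would
  contain a countable set through \<open>x\<close>. Hence \<open>\<F>\<close> is infinite, and a
  countably infinite subfamily, whose union is countable, has size below
  \<open>\<kappa>\<close>.\<close>

lemma infinite_Field_if_sparse_cofinal_family:
  assumes \<kappa>: "Card_order \<kappa>" and D: "uncountable D"
    and cof: "cofinal_family (countably_infinite_subsets D) \<F>"
    and sp: "sparse_family \<kappa> aleph1 \<F>"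
  shows "infinite (Field \<kappa>)"
proof -
  have count: "countable A" if "A \<in> \<F>" for A
    using that cof by (auto simp: cofinal_family_def countably_infinite_subsets_def)
  have "infinite \<F>"
  proof
    assume "finite \<F>"
    then have "countable (\<Union>\<F>)"
      using count countable_UN[of \<F> id] by (simp add: countable_finite)
    then obtain x where x: "x \<in> D" "x \<notin> \<Union>\<F>"
      using D by (meson countable_subset subsetI)
    have "infinite D"
      using D by (auto simp: countable_finite)
    then obtain C where "C \<subseteq> D" "countable C" "infinite C"
      using infinite_countable_subset' by blast
    then have "insert x C \<in> countably_infinite_subsets D"
      using x by (auto simp: countably_infinite_subsets_def)
    then show False
      using cofinal_familyD[OF cof] x(2) by blast
  qed
  then obtain \<G> where \<G>: "\<G> \<subseteq> \<F>" "countable \<G>" "infinite \<G>"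
    using infinite_countable_subset' by blast
  then have "countable (\<Union>\<G>)"
    using count countable_UN[of \<G> id] by (simp add: subset_eq)
  then have "card_of \<G> <o \<kappa>"
    by (rule sparse_family_aleph1D[OF sp \<kappa> \<G>(1)])
  then have "card_of \<G> \<le>o card_of (Field \<kappa>)"
    using \<kappa> by (meson card_of_Field_ordIso ordIso_symmetric ordLess_imp_ordLeq ordLeq_ordIso_trans)
  then show ?thesis
    using \<G>(3) card_of_ordLeq_infinite by blast
qed

lemma op_like_base_if_sparse_cofinal_family:
  assumes \<kappa>: "Card_order \<kappa>" and D: "infinite D" and p: "p \<notin> D"
    and cof: "cofinal_family (countably_infinite_subsets D) \<F>"
    and sp: "sparse_family \<kappa> aleph1 \<F>"
  shows "has_op_like_base (Pixley_Roy (one_point_Lindelofication p D)) \<kappa>"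
proof (cases "countable D")
  case True
  \<comment> \<open>Cofinality at \<open>D\<close> itself supplies a member \<open>A\<close>;
    sparseness for the subfamily \<open>{A}\<close> then yields \<open>1 < \<kappa>\<close>.\<close>
  then have "D \<in> countably_infinite_subsets D"
    using D by (auto simp: countably_infinite_subsets_def)
  then obtain A where A: "A \<in> \<F>"
    using cofinal_familyD[OF cof] by blast
  then have "countable A"
    using sp by (simp add: sparse_family_def)
  with A have "card_of {A} <o \<kappa>"
    by (intro sparse_family_aleph1D[OF sp \<kappa>]) auto
  then show ?thesis
    using True p by (intro op_like_base_if_countable)
next
  case False
  then have "infinite (Field \<kappa>)"
    by (rule infinite_Field_if_sparse_cofinal_family[OF \<kappa> _ cof sp])
  then show ?thesis
    by (rule op_like_base_if_infinite[OF \<kappa> _ D p cof sp])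
qed

theorem theorem4p4:
  fixes \<kappa> :: "'k rel" and \<mu> :: "'m rel" and D :: "'d set" and p :: 'd
  assumes "Card_order \<kappa>"
    and "Card_order \<mu>" and "infinite (Field \<mu>)"
    and "card_of D =o \<mu>" and "p \<notin> D"
  shows "Noetherian_type (Pixley_Roy (one_point_Lindelofication p D)) \<le>o \<kappa> \<longleftrightarrow>
    (\<exists>\<F>. cofinal_family (countably_infinite_subsets (Field \<mu>)) \<F> \<and> sparse_family \<kappa> aleph1 \<F>)"
proof -
  have "card_of D =o card_of (Field \<mu>)"
    using assms(2,4) by (meson card_of_Field_ordIso ordIso_symmetric ordIso_transitive)
  then obtain h where h: "bij_betw h D (Field \<mu>)"
    using card_of_ordIso by blast
  then have D: "infinite D"
    using assms(3) bij_betw_finite by blast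
  \<comment> \<open>The transfer lemma works in one direction only, so it is applied to
    \<open>h\<close> and to its inverse.\<close>
  have "(\<exists>\<F>. cofinal_family (countably_infinite_subsets (Field \<mu>)) \<F> \<and> sparse_family \<kappa> aleph1 \<F>)
    \<longleftrightarrow> (\<exists>\<F>. cofinal_family (countably_infinite_subsets D) \<F> \<and> sparse_family \<kappa> aleph1 \<F>)"
    using sparse_cofinal_family_transfer[OF assms(1) h]
      sparse_cofinal_family_transfer[OF assms(1) bij_betw_inv_into[OF h]] by blast
  also have "\<dots> \<longleftrightarrow> has_op_like_base (Pixley_Roy (one_point_Lindelofication p D)) \<kappa>"
    using sparse_cofinal_family_if_op_like_base[OF assms(1) D assms(5)]
      op_like_base_if_sparse_cofinal_family[OF assms(1) D assms(5)] by blast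
  finally show ?thesis
    unfolding Noetherian_type_ordLeq_iff[OF assms(1)] by blast
qed

end
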